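(* Let $n\ge 2$ and $k\ge 1$ be integers, let $\rho>0$, and consider the path planning problem for a Reeds-Shepp vehicle with minimum turning radius $\rho$ visiting $n$ waypoints when the sequence of waypoints is not specified, where the orientation at waypoint $i\in\{1,\dots,n\}$ must lie in $I_i=[\theta_i^{min},\theta_i^{max}]$ with $\theta_i^{min}<\theta_i^{max}$. Then the length of the feasible solution obtained by the modified algorithm $Approx$ (with $k$ intervals per waypoint) is at most $$Cost^{tsp}_{lb}+3\rho\sum_{i=1}^{n}\frac{\theta_{s_i}^{max}-\theta_{s_i}^{min}}{k},$$ where $(s_1,\dots,s_n)$ is the sequence of waypoints found by the algorithm and $Cost^{tsp}_{lb}$ is the length of the lower bounding solution to the problem when the sequence of waypoints is not specified.
   Context: Reeds-Shepp paths: trajectories of $\dot x=u_1\cos\theta$, $\dot y=u_1\sin\theta$, $\dot\theta=u_2$ with $u_1\in\{-1,+1\}$, $u_2\in[-\frac1\rho,\frac1\rho]$; the length of a path equals its duration; orientations are modulo $2\pi$. Waypoint $i$ is located at $(x_i,y_i)\in\mathbb{R}^2$. For orientations $\theta_i,\theta_j$, $d_{ij}(\theta_i,\theta_j)$ is the length of the shortest Reeds-Shepp path from $(x_i,y_i,\theta_i)$ to $(x_j,y_j,\theta_j)$. Path planning problem (sequence not given): find an ordering $(s_1,\dots,s_n)$ of the waypoints (each visited once) and orientations $\theta_{s_i}\in I_{s_i}$ minimizing $\sum_{i=1}^{n-1}d_{s_is_{i+1}}(\theta_{s_i},\theta_{s_{i+1}})+d_{s_ns_1}(\theta_{s_n},\theta_{s_1})$.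 Modified algorithm $Approx$: (1) For each waypoint $i$, partition $I_i$ into $k$ intervals $[\phi_{i(j-1)},\phi_{ij}]$, $j=1,\dots,k$, where $\phi_{ij}=\theta_i^{min}+\frac{j}{k}(\theta_i^{max}-\theta_i^{min})$. (2) For all waypoints $i\ne j$ and $m,l\in\{1,\dots,k\}$, let $c\big((i,m),(j,l)\big)=\min d_{ij}(\theta,\theta')$ over $\theta\in[\phi_{i(m-1)},\phi_{im}]$ and $\theta'\in[\phi_{j(l-1)},\phi_{jl}]$. (3) (One-in-a-set TSP) Find an ordering $(s_1,\dots,s_n)$ of the waypoints and one interval index $m_i\in\{1,\dots,k\}$ at each $s_i$ minimizing $\sum_{i=1}^{n-1}c\big((s_i,m_i),(s_{i+1},m_{i+1})\big)+c\big((s_n,m_n),(s_1,m_1)\big)$. The minimum value is $Cost^{tsp}_{lb}$. (4) In the cyclic tour found in step (3), each waypoint $s_i$ has an arrival angle $\theta_{s_ia}$ and a departure angle $\theta_{s_id}$, taken from minimizers defining the two costs of the tour incident to $s_i$. Choose $\theta_{s_i}\in\{\theta_{s_ia},\theta_{s_id}\}$ for every $i=1,\dots,n$ so that $\sum_{i=1}^{n-1}d_{s_is_{i+1}}(\theta_{s_i},\theta_{s_{i+1}})+d_{s_ns_1}(\theta_{s_n},\theta_{s_1})$ is minimized over all such choices. The resulting closed path is the feasible solution obtained by the modified $Approx$. *)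

theory Defs
  imports
    "HOL-Analysis.Analysis"
    "HOL-Library.Real_Mod"
    "HOL-Library.FuncSet"
    "HOL-Combinatorics.Permutations"
begin

(* The differential equation is stated in integrated form (Caratheodory solutions), so the controls
   may be arbitrary measurable functions.  Measurability need not be required separately: u2 and the
   functions u1 * cos th, u1 * sin th are integrable, and
   u1 = (u1 * cos th) * cos th + (u1 * sin th) * sin th with th continuous.
   The orientation th is a real-valued lift of the heading. *)

definition reeds_shepp_path ::
  "real \<Rightarrow> real \<Rightarrow> (real \<Rightarrow> real) \<Rightarrow> (real \<Rightarrow> real) \<Rightarrow> (real \<Rightarrow> real) \<Rightarrow> (real \<Rightarrow> real) \<Rightarrow> (real \<Rightarrow> real) \<Rightarrow> bool"
  where
  "reeds_shepp_path \<rho> T u1 u2 x y th \<longleftrightarrow>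
     0 \<le> T \<and>
     (\<forall>t\<in>{0..T}. u1 t \<in> {-1, 1} \<and> u2 t \<in> {-(1/\<rho>)..1/\<rho>}) \<and>
     (\<forall>t\<in>{0..T}.
        ((\<lambda>r. u1 r * cos (th r)) has_integral (x t - x 0)) {0..t} \<and>
        ((\<lambda>r. u1 r * sin (th r)) has_integral (y t - y 0)) {0..t} \<and>
        (u2 has_integral (th t - th 0)) {0..t})"

definition rs_path_lengths ::
  "real \<Rightarrow> real \<times> real \<Rightarrow> real \<Rightarrow> real \<times> real \<Rightarrow> real \<Rightarrow> real set"
  where
  "rs_path_lengths \<rho> p \<alpha> q \<beta> =
     {T. \<exists>u1 u2 x y th. reeds_shepp_path \<rho> T u1 u2 x y th \<and>
           (x 0, y 0) = p \<and> [th 0 = \<alpha>] (rmod (2 * pi)) \<and>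
           (x T, y T) = q \<and> [th T = \<beta>] (rmod (2 * pi))}"

(* The infimum is attained by the classical existence theorem for shortest Reeds-Shepp paths, and the
   set is nonempty because any two configurations can be joined. *)

definition rs_dist :: "real \<Rightarrow> real \<times> real \<Rightarrow> real \<Rightarrow> real \<times> real \<Rightarrow> real \<Rightarrow> real"
  where
  "rs_dist \<rho> p \<alpha> q \<beta> = Inf (rs_path_lengths \<rho> p \<alpha> q \<beta>)"

(* In the following, waypoints are the indices 1..n; pos i is the location of waypoint i and
   {lo i..hi i} its interval of admissible orientations.  A sequence is a function s with
   s permutes {1..n}: the waypoint in position i is s i. *)

definition tour_length ::
  "real \<Rightarrow> nat \<Rightarrow> (nat \<Rightarrow> real \<times> real) \<Rightarrow> (nat \<Rightarrow> nat) \<Rightarrow> (nat \<Rightarrow> real) \<Rightarrow> real"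
  where
  "tour_length \<rho> n pos s \<theta> =
     (\<Sum>i=1..n-1. rs_dist \<rho> (pos (s i)) (\<theta> (s i)) (pos (s (i+1))) (\<theta> (s (i+1))))
     + rs_dist \<rho> (pos (s n)) (\<theta> (s n)) (pos (s 1)) (\<theta> (s 1))"

definition grid_point :: "nat \<Rightarrow> (nat \<Rightarrow> real) \<Rightarrow> (nat \<Rightarrow> real) \<Rightarrow> nat \<Rightarrow> nat \<Rightarrow> real"
  where
  "grid_point k lo hi i j = lo i + real j / real k * (hi i - lo i)"

definition subinterval :: "nat \<Rightarrow> (nat \<Rightarrow> real) \<Rightarrow> (nat \<Rightarrow> real) \<Rightarrow> nat \<Rightarrow> nat \<Rightarrow> real set"
  where
  "subinterval k lo hi i m = {grid_point k lo hi i (m - 1)..grid_point k lo hi i m}"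

definition interval_cost ::
  "real \<Rightarrow> nat \<Rightarrow> (nat \<Rightarrow> real \<times> real) \<Rightarrow> (nat \<Rightarrow> real) \<Rightarrow> (nat \<Rightarrow> real) \<Rightarrow> nat \<times> nat \<Rightarrow> nat \<times> nat \<Rightarrow> real"
  where
  "interval_cost \<rho> k pos lo hi = (\<lambda>(i, m) (j, l).
     INF (\<alpha>, \<beta>) \<in> subinterval k lo hi i m \<times> subinterval k lo hi j l.
       rs_dist \<rho> (pos i) \<alpha> (pos j) \<beta>)"

definition is_cost_minimizer ::
  "real \<Rightarrow> nat \<Rightarrow> (nat \<Rightarrow> real \<times> real) \<Rightarrow> (nat \<Rightarrow> real) \<Rightarrow> (nat \<Rightarrow> real) \<Rightarrow> nat \<times> nat \<Rightarrow> nat \<times> nat \<Rightarrow>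
   real \<Rightarrow> real \<Rightarrow> bool"
  where
  "is_cost_minimizer \<rho> k pos lo hi = (\<lambda>(i, m) (j, l) \<alpha> \<beta>.
     \<alpha> \<in> subinterval k lo hi i m \<and> \<beta> \<in> subinterval k lo hi j l \<and>
     rs_dist \<rho> (pos i) \<alpha> (pos j) \<beta> = interval_cost \<rho> k pos lo hi (i, m) (j, l))"

(* The interval index m is a function of the position in the sequence: m i is the index chosen at
   waypoint s i. *)

definition tsp_solutions :: "nat \<Rightarrow> nat \<Rightarrow> ((nat \<Rightarrow> nat) \<times> (nat \<Rightarrow> nat)) set"
  where
  "tsp_solutions n k = {s. s permutes {1..n}} \<times> ({1..n} \<rightarrow>\<^sub>E {1..k})"

definition tsp_cost ::
  "real \<Rightarrow> nat \<Rightarrow> nat \<Rightarrow> (nat \<Rightarrow> real \<times> real) \<Rightarrow> (nat \<Rightarrow> real) \<Rightarrow> (nat \<Rightarrow> real) \<Rightarrow>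
   (nat \<Rightarrow> nat) \<times> (nat \<Rightarrow> nat) \<Rightarrow> real"
  where
  "tsp_cost \<rho> n k pos lo hi = (\<lambda>(s, m).
     (\<Sum>i=1..n-1. interval_cost \<rho> k pos lo hi (s i, m i) (s (i+1), m (i+1)))
     + interval_cost \<rho> k pos lo hi (s n, m n) (s 1, m 1))"

definition tsp_lower_bound ::
  "real \<Rightarrow> nat \<Rightarrow> nat \<Rightarrow> (nat \<Rightarrow> real \<times> real) \<Rightarrow> (nat \<Rightarrow> real) \<Rightarrow> (nat \<Rightarrow> real) \<Rightarrow> real"
  where
  "tsp_lower_bound \<rho> n k pos lo hi = Min (tsp_cost \<rho> n k pos lo hi ` tsp_solutions n k)"

(* One possible outcome of the algorithm: the sequence s and the final orientations \<theta> (indexed by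
   waypoint).  The algorithm is nondeterministic, as optimal tours and minimizers need not be unique.
   arr and dep are the arrival and departure angles. *)

definition approx_result ::
  "real \<Rightarrow> nat \<Rightarrow> nat \<Rightarrow> (nat \<Rightarrow> real \<times> real) \<Rightarrow> (nat \<Rightarrow> real) \<Rightarrow> (nat \<Rightarrow> real) \<Rightarrow>
   (nat \<Rightarrow> nat) \<Rightarrow> (nat \<Rightarrow> real) \<Rightarrow> bool"
  where
  "approx_result \<rho> n k pos lo hi s \<theta> \<longleftrightarrow>
     (\<exists>m arr dep.
        (s, m) \<in> tsp_solutions n k \<and>
        tsp_cost \<rho> n k pos lo hi (s, m) = tsp_lower_bound \<rho> n k pos lo hi \<and>
        (\<forall>i\<in>{1..n-1}. is_cost_minimizer \<rho> k pos lo hi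
            (s i, m i) (s (i+1), m (i+1)) (dep (s i)) (arr (s (i+1)))) \<and>
        is_cost_minimizer \<rho> k pos lo hi (s n, m n) (s 1, m 1) (dep (s n)) (arr (s 1)) \<and>
        is_arg_min (tour_length \<rho> n pos s)
          (\<lambda>\<theta>'. \<forall>i\<in>{1..n}. \<theta>' (s i) \<in> {arr (s i), dep (s i)}) \<theta>)"

end

theory Submission
  imports Defs
begin

(* A Reeds-Shepp vehicle can turn on the spot: steering at full lock on one side and switching the
   gear twice, it turns by any angle d in [0, 2 pi] and comes back to its starting point within
   time \<rho> * d.  The condition for closing up is sin a = sin (d / 2) / 2, where a is half of the angle
   turned in reverse gear.  Hence changing the orientation at one end of a path by d changes the
   distance by at most \<rho> * d.  Choosing the departure angle at every waypoint, each leg of the tour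
   ends with an orientation that is off from the cost minimizer by at most the length of a
   subinterval, which gives the bound even with the factor 1 instead of 3. *)

section \<open>Concatenation of paths\<close>

lemma has_integral_join:
  fixes f g :: "real \<Rightarrow> real"
  assumes "0 \<le> a" "0 \<le> b" and f: "(f has_integral I) {0..a}" and g: "(g has_integral J) {0..b}"
  shows "((\<lambda>r. if r \<le> a then f r else g (r - a)) has_integral (I + J)) {0..a + b}"
proof (rule has_integral_combine)
  show "((\<lambda>r. if r \<le> a then f r else g (r - a)) has_integral I) {0..a}"
    by (rule has_integral_eq[OF _ f]) auto
  have "((\<lambda>r. g (r - a)) has_integral J) {a..a + b}"
    using has_integral_shift_real_ivl[OF g, of "- a"] by (simp add: add.commute)
  \<comment> \<open>At the joint \<open>a\<close> the two integrands may differ; a single point does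
    not affect the integral.\<close>
  then show "((\<lambda>r. if r \<le> a then f r else g (r - a)) has_integral J) {a..a + b}"
    by (rule has_integral_spike_finite[rotated 2, where S = "{a}"]) auto
qed (use assms in auto)

text \<open>The subtrahend is left as the value at 0 of the joined primitive, so that the lemma matches the
  conditions in \<^const>\<open>reeds_shepp_path\<close>.\<close>

lemma has_integral_primitive_join:
  fixes f g F G :: "real \<Rightarrow> real"
  assumes "0 \<le> a" "t \<in> {0..a + b}" "F a = G 0"
    and f: "\<And>t. t \<in> {0..a} \<Longrightarrow> (f has_integral (F t - F 0)) {0..t}"
    and g: "\<And>t. t \<in> {0..b} \<Longrightarrow> (g has_integral (G t - G 0)) {0..t}"
  shows "((\<lambda>r. if r \<le> a then f r else g (r - a)) has_integral
           ((if t \<le> a then F t else G (t - a)) - (if 0 \<le> a then F 0 else G (0 - a)))) {0..t}"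
proof (cases "t \<le> a")
  case True
  have "((\<lambda>r. if r \<le> a then f r else g (r - a)) has_integral (F t - F 0)) {0..t}"
    by (rule has_integral_eq[OF _ f]) (use True assms in auto)
  then show ?thesis using True assms by simp
next
  case False
  have "((\<lambda>r. if r \<le> a then f r else g (r - a)) has_integral
          ((F a - F 0) + (G (t - a) - G 0))) {0..a + (t - a)}"
    by (rule has_integral_join[OF _ _ f g]) (use False assms(1,2) in auto)
  then show ?thesis using False assms by simp
qed

text \<open>The headings of the two paths agree at the joint only modulo 2 pi. The second lift is
  therefore shifted by the constant \<open>c\<close>, a multiple of 2 pi, which makes the joined
  lift continuous and changes neither cos nor sin.\<close>

lemma rs_path_lengths_add:
  assumes "T \<in> rs_path_lengths \<rho> p \<alpha> q \<beta>" and "T' \<in> rs_path_lengths \<rho> q \<beta> r \<gamma>"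
  shows "T + T' \<in> rs_path_lengths \<rho> p \<alpha> r \<gamma>"
proof -
  obtain u1 u2 x y th where P: "reeds_shepp_path \<rho> T u1 u2 x y th"
    and p: "(x 0, y 0) = p" "[th 0 = \<alpha>] (rmod (2 * pi))"
      "(x T, y T) = q" "[th T = \<beta>] (rmod (2 * pi))"
    using assms(1) unfolding rs_path_lengths_def by blast
  obtain v1 v2 x' y' th' where P': "reeds_shepp_path \<rho> T' v1 v2 x' y' th'"
    and p': "(x' 0, y' 0) = q" "[th' 0 = \<beta>] (rmod (2 * pi))"
      "(x' T', y' T') = r" "[th' T' = \<gamma>] (rmod (2 * pi))"
    using assms(2) unfolding rs_path_lengths_def by blast
  define c where "c = th T - th' 0"
  have "[th' 0 = th T] (rmod (2 * pi))"
    using p(4) p'(2) by (meson rcong_sym rcong_trans)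
  then have "[th' 0 - th' 0 = th T - th' 0] (rmod (2 * pi))"
    by (rule rcong_diff) simp
  then have c: "[0 = c] (rmod (2 * pi))"
    by (simp add: c_def)
  have per: "[a = a + c] (rmod (2 * pi))" for a
    using rcong_add[OF rcong_refl[of a] c] by simp
  let ?J = "\<lambda>F G t :: real. if t \<le> T then F t else G (t - T) :: real"
  let ?th = "?J th (\<lambda>t. th' t + c)"
  from P have T: "0 \<le> T" and ctrl: "\<And>t. t \<in> {0..T} \<Longrightarrow> u1 t \<in> {-1, 1} \<and> u2 t \<in> {-(1/\<rho>)..1/\<rho>}"
    and ix: "\<And>t. t \<in> {0..T} \<Longrightarrow> ((\<lambda>r. u1 r * cos (th r)) has_integral (x t - x 0)) {0..t}"
    and iy: "\<And>t. t \<in> {0..T} \<Longrightarrow> ((\<lambda>r. u1 r * sin (th r)) has_integral (y t - y 0)) {0..t}"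
    and ith: "\<And>t. t \<in> {0..T} \<Longrightarrow> (u2 has_integral (th t - th 0)) {0..t}"
    unfolding reeds_shepp_path_def by blast+
  \<comment> \<open>In \<open>ith'\<close> both values carry \<open>+ c\<close>, so that the fact
    speaks of the shifted lift used in \<open>?th\<close>.\<close>
  from P' have T': "0 \<le> T'" and ctrl': "\<And>t. t \<in> {0..T'} \<Longrightarrow> v1 t \<in> {-1, 1} \<and> v2 t \<in> {-(1/\<rho>)..1/\<rho>}"
    and ix': "\<And>t. t \<in> {0..T'} \<Longrightarrow> ((\<lambda>r. v1 r * cos (th' r)) has_integral (x' t - x' 0)) {0..t}"
    and iy': "\<And>t. t \<in> {0..T'} \<Longrightarrow> ((\<lambda>r. v1 r * sin (th' r)) has_integral (y' t - y' 0)) {0..t}"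
    and ith': "\<And>t. t \<in> {0..T'} \<Longrightarrow> (v2 has_integral (th' t + c - (th' 0 + c))) {0..t}"
    unfolding reeds_shepp_path_def by simp_all
  have eqx: "x T = x' 0" "y T = y' 0"
    using p p' by auto
  have jc: "?J u1 v1 r * cos (?th r) = ?J (\<lambda>r. u1 r * cos (th r)) (\<lambda>r. v1 r * cos (th' r)) r"
    and js: "?J u1 v1 r * sin (?th r) = ?J (\<lambda>r. u1 r * sin (th r)) (\<lambda>r. v1 r * sin (th' r)) r" for r
    using cos_rcong[OF per[of "th' (r - T)"]] sin_rcong[OF per[of "th' (r - T)"]] by simp_all
  have "reeds_shepp_path \<rho> (T + T') (?J u1 v1) (?J u2 v2) (?J x x') (?J y y') ?th"
    unfolding reeds_shepp_path_def jc js
  proof (intro conjI ballI)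
    fix t assume t: "t \<in> {0..T + T'}"
    show "?J u1 v1 t \<in> {-1, 1}" "?J u2 v2 t \<in> {-(1/\<rho>)..1/\<rho>}"
      using ctrl[of t] ctrl'[of "t - T"] t by auto
    show "(?J (\<lambda>r. u1 r * cos (th r)) (\<lambda>r. v1 r * cos (th' r)) has_integral
             (?J x x' t - ?J x x' 0)) {0..t}"
      by (rule has_integral_primitive_join[OF T t eqx(1) ix ix'])
    show "(?J (\<lambda>r. u1 r * sin (th r)) (\<lambda>r. v1 r * sin (th' r)) has_integral
             (?J y y' t - ?J y y' 0)) {0..t}"
      by (rule has_integral_primitive_join[OF T t eqx(2) iy iy'])
    show "(?J u2 v2 has_integral (?th t - ?th 0)) {0..t}"
      by (rule has_integral_primitive_join[OF T t _ ith ith']) (auto simp: c_def)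
  qed (use T T' in auto)
  moreover have "(?J x x' 0, ?J y y' 0) = p" "[?th 0 = \<alpha>] (rmod (2 * pi))"
    using T p by auto
  \<comment> \<open>If \<open>T' = 0\<close>, the final time falls into the first branch of
    \<open>?J\<close>, and the end values come from the agreement at the joint.\<close>
  moreover have "(?J x x' (T + T'), ?J y y' (T + T')) = r"
    using T T' p' eqx by (cases "T' = 0") auto
  moreover have "?th (T + T') = th' T' + c"
    using T' by (cases "T' = 0") (auto simp: c_def)
  then have "[?th (T + T') = \<gamma>] (rmod (2 * pi))"
    using rcong_trans[OF rcong_sym[OF per[of "th' T'"]] p'(4)] by (simp only:)
  ultimately show ?thesis
    unfolding rs_path_lengths_def by blast
qed

section \<open>Circular arcs and turning on the spot\<close>

text \<open>Constant controls at full lock: \<open>v\<close> is the gear, \<sigma> the steering side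
  and \<open>d\<close> the angle turned. The vehicle moves on a circle of radius \<rho>, and the
  endpoint results from integrating the heading's cosine and sine.\<close>

lemma rs_path_lengths_arc:
  fixes \<rho> \<sigma> v d \<alpha> X Y :: real
  assumes "\<rho> > 0" "\<sigma> \<in> {-1, 1}" "v \<in> {-1, 1}" "0 \<le> d"
  shows "\<rho> * d \<in> rs_path_lengths \<rho> (X, Y) \<alpha>
           (X + v * \<sigma> * \<rho> * (sin (\<alpha> + \<sigma> * d) - sin \<alpha>),
            Y - v * \<sigma> * \<rho> * (cos (\<alpha> + \<sigma> * d) - cos \<alpha>)) (\<alpha> + \<sigma> * d)"
proof -
  let ?th = "\<lambda>t. \<alpha> + \<sigma> * (t / \<rho>)"
  let ?x = "\<lambda>t. X + v * \<sigma> * \<rho> * (sin (?th t) - sin \<alpha>)"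
  let ?y = "\<lambda>t. Y - v * \<sigma> * \<rho> * (cos (?th t) - cos \<alpha>)"
  have \<sigma>: "\<sigma> * \<sigma> = 1"
    using assms(2) by auto
  have \<rho>0: "\<rho> \<noteq> 0"
    using assms(1) by simp
  have "reeds_shepp_path \<rho> (\<rho> * d) (\<lambda>_. v) (\<lambda>_. \<sigma> / \<rho>) ?x ?y ?th"
    unfolding reeds_shepp_path_def
  proof (intro conjI ballI)
    fix t assume "t \<in> {0..\<rho> * d}"
    then have t: "0 \<le> t" by simp
    show "\<sigma> / \<rho> \<in> {-(1/\<rho>)..1/\<rho>}"
      using assms by (auto simp: field_simps)
    \<comment> \<open>The chain rule brings in a second factor \<sigma>, which cancels because
      \<sigma> is a sign.\<close>
    have "v * \<sigma> * \<rho> * (cos (?th r) * (\<sigma> / \<rho>)) = (\<sigma> * \<sigma>) * (v * cos (?th r))" for r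
      using assms(1) by simp
    then have "(?x has_vector_derivative v * cos (?th r)) (at r within {0..t})" for r
      unfolding has_real_derivative_iff_has_vector_derivative[symmetric]
      by (auto intro!: derivative_eq_intros simp: \<sigma> \<rho>0 algebra_simps)
    then show "((\<lambda>r. v * cos (?th r)) has_integral (?x t - ?x 0)) {0..t}"
      by (rule fundamental_theorem_of_calculus[OF t])
    have "v * \<sigma> * \<rho> * (sin (?th r) * (\<sigma> / \<rho>)) = (\<sigma> * \<sigma>) * (v * sin (?th r))" for r
      using assms(1) by simp
    then have "(?y has_vector_derivative v * sin (?th r)) (at r within {0..t})" for r
      unfolding has_real_derivative_iff_has_vector_derivative[symmetric]
      by (auto intro!: derivative_eq_intros simp: \<sigma> \<rho>0 algebra_simps)
    then show "((\<lambda>r. v * sin (?th r)) has_integral (?y t - ?y 0)) {0..t}"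
      by (rule fundamental_theorem_of_calculus[OF t])
    show "((\<lambda>_. \<sigma> / \<rho>) has_integral (?th t - ?th 0)) {0..t}"
      using has_integral_const_real[of "\<sigma> / \<rho>" 0 t] t by (simp add: mult.commute)
  qed (use assms in auto)
  moreover have "(?x 0, ?y 0) = (X, Y)" "[?th 0 = \<alpha>] (rmod (2 * pi))"
    by simp_all
  moreover have "(?x (\<rho> * d), ?y (\<rho> * d)) =
      (X + v * \<sigma> * \<rho> * (sin (\<alpha> + \<sigma> * d) - sin \<alpha>),
       Y - v * \<sigma> * \<rho> * (cos (\<alpha> + \<sigma> * d) - cos \<alpha>))"
    "[?th (\<rho> * d) = \<alpha> + \<sigma> * d] (rmod (2 * pi))"
    using \<rho>0 by simp_all
  ultimately show ?thesis
    unfolding rs_path_lengths_def by blast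
qed

lemma rs_path_lengths_turn_on_spot:
  assumes \<rho>: "\<rho> > 0" and \<sigma>: "\<sigma> \<in> {-1, 1}" and d: "0 \<le> d" "d \<le> 2 * pi"
  shows "\<rho> * d \<in> rs_path_lengths \<rho> p \<alpha> p (\<alpha> + \<sigma> * d)"
proof -
  obtain X Y where p: "p = (X, Y)" by (cases p)
  define h where "h = d / 2"
  define a where "a = arcsin (sin h / 2)"
  have h: "0 \<le> h" "h \<le> pi"
    using d by (auto simp: h_def)
  have sh: "0 \<le> sin h" "sin h \<le> 1"
    using h sin_ge_zero by auto
  have sa: "2 * sin a = sin h"
    unfolding a_def by (subst sin_arcsin) (use sh in linarith)+
  have "0 \<le> a" "a \<le> pi / 2"
    using order_trans[OF sh(2), of 2] sh(1) arcsin_le_arcsin[of 0 "sin h / 2"] arcsin_ubound[of "sin h / 2"]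
    by (auto simp: a_def)
  \<comment> \<open>This makes the durations of the two forward arcs, \<rho> * (h - a) each,
    nonnegative.\<close>
  have "a \<le> h"
  proof (cases "h \<le> pi / 2")
    case True
    then have "a \<le> arcsin (sin h)"
      unfolding a_def using sh by (intro arcsin_le_arcsin) auto
    then show ?thesis using True h by (simp add: arcsin_sin)
  next
    case False
    then show ?thesis using \<open>a \<le> pi / 2\<close> by simp
  qed
  \<comment> \<open>The manoeuvre is symmetric about the middle heading \<mu>: forward through h -
    a, reverse through 2 a, forward through h - a. Its displacement is 2 \<rho> \<sigma> (sin
    (\<sigma> h) - 2 sin (\<sigma> a)) times the vector (cos \<mu>, sin \<mu>), so the choice of
    \<open>a\<close> closes it up.\<close>
  define \<mu> where "\<mu> = \<alpha> + \<sigma> * h"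
  define x1 where "x1 = X + 1 * \<sigma> * \<rho> * (sin (\<mu> - \<sigma> * a) - sin (\<mu> - \<sigma> * h))"
  define y1 where "y1 = Y - 1 * \<sigma> * \<rho> * (cos (\<mu> - \<sigma> * a) - cos (\<mu> - \<sigma> * h))"
  define x2 where "x2 = x1 + (-1) * \<sigma> * \<rho> * (sin (\<mu> + \<sigma> * a) - sin (\<mu> - \<sigma> * a))"
  define y2 where "y2 = y1 - (-1) * \<sigma> * \<rho> * (cos (\<mu> + \<sigma> * a) - cos (\<mu> - \<sigma> * a))"
  define x3 where "x3 = x2 + 1 * \<sigma> * \<rho> * (sin (\<mu> + \<sigma> * h) - sin (\<mu> + \<sigma> * a))"
  define y3 where "y3 = y2 - 1 * \<sigma> * \<rho> * (cos (\<mu> + \<sigma> * h) - cos (\<mu> + \<sigma> * a))"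
  have ang: "\<mu> - \<sigma> * h + \<sigma> * (h - a) = \<mu> - \<sigma> * a" "\<mu> - \<sigma> * a + \<sigma> * (2 * a) = \<mu> + \<sigma> * a"
    "\<mu> + \<sigma> * a + \<sigma> * (h - a) = \<mu> + \<sigma> * h"
    by (auto simp: algebra_simps)
  have "\<rho> * (h - a) \<in> rs_path_lengths \<rho> (X, Y) (\<mu> - \<sigma> * h) (x1, y1) (\<mu> - \<sigma> * a)"
    using rs_path_lengths_arc[OF \<rho> \<sigma>, of 1 "h - a" X Y "\<mu> - \<sigma> * h"] \<open>a \<le> h\<close>
    unfolding ang x1_def y1_def by simp
  moreover have "\<rho> * (2 * a) \<in> rs_path_lengths \<rho> (x1, y1) (\<mu> - \<sigma> * a) (x2, y2) (\<mu> + \<sigma> * a)"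
    using rs_path_lengths_arc[OF \<rho> \<sigma>, of "-1" "2 * a" x1 y1 "\<mu> - \<sigma> * a"] \<open>0 \<le> a\<close>
    unfolding ang x2_def y2_def by simp
  moreover have "\<rho> * (h - a) \<in> rs_path_lengths \<rho> (x2, y2) (\<mu> + \<sigma> * a) (x3, y3) (\<mu> + \<sigma> * h)"
    using rs_path_lengths_arc[OF \<rho> \<sigma>, of 1 "h - a" x2 y2 "\<mu> + \<sigma> * a"] \<open>a \<le> h\<close>
    unfolding ang x3_def y3_def by simp
  ultimately have "\<rho> * (h - a) + \<rho> * (2 * a) + \<rho> * (h - a)
      \<in> rs_path_lengths \<rho> (X, Y) (\<mu> - \<sigma> * h) (x3, y3) (\<mu> + \<sigma> * h)"
    by (intro rs_path_lengths_add)
  moreover have "\<rho> * (h - a) + \<rho> * (2 * a) + \<rho> * (h - a) = \<rho> * d"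
    by (simp add: h_def algebra_simps)
  moreover have "\<mu> - \<sigma> * h = \<alpha>" "\<mu> + \<sigma> * h = \<alpha> + \<sigma> * d"
    by (auto simp: \<mu>_def h_def)
  moreover have "sin (\<sigma> * h) = 2 * sin (\<sigma> * a)"
    using \<sigma> sa by auto
  then have "x3 = X" "y3 = Y"
    unfolding x3_def y3_def x2_def y2_def x1_def y1_def
    by (simp_all add: sin_add sin_diff cos_add cos_diff algebra_simps)
  ultimately show ?thesis
    unfolding p by simp
qed

lemma rs_path_lengths_rcong:
  assumes "[\<beta> = \<gamma>] (rmod (2 * pi))"
  shows "rs_path_lengths \<rho> p \<alpha> q \<beta> = rs_path_lengths \<rho> p \<alpha> q \<gamma>"
  using assms unfolding rs_path_lengths_def rcong_def by simp

lemma rs_path_lengths_turn: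
  assumes "\<rho> > 0" and "T \<in> rs_path_lengths \<rho> p \<alpha> q \<beta>"
  shows "\<exists>T' \<in> rs_path_lengths \<rho> p \<alpha> q \<gamma>. T' \<le> T + \<rho> * \<bar>\<gamma> - \<beta>\<bar>"
proof -
  define \<sigma> :: real where "\<sigma> = (if \<beta> \<le> \<gamma> then 1 else -1)"
  have \<sigma>: "\<sigma> \<in> {-1, 1}" "\<gamma> = \<beta> + \<sigma> * \<bar>\<gamma> - \<beta>\<bar>"
    by (auto simp: \<sigma>_def)
  \<comment> \<open>The turn on the spot is available for angles up to 2 pi. Dropping full turns
    keeps the final heading modulo 2 pi and does not increase the cost.\<close>
  define d where "d = \<bar>\<gamma> - \<beta>\<bar> rmod (2 * pi)"
  have d: "0 \<le> d" "d \<le> 2 * pi"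
    by (auto simp: d_def rmod_nonneg rmod_le)
  have d_le: "d \<le> \<bar>\<gamma> - \<beta>\<bar>"
    by (simp add: d_def rmod_def)
  have "[d = \<bar>\<gamma> - \<beta>\<bar>] (rmod (2 * pi))"
    by (simp add: d_def)
  then have "[\<sigma> * d = \<sigma> * \<bar>\<gamma> - \<beta>\<bar>] (rmod (2 * pi))"
    using \<sigma>(1) by auto
  then have "[\<beta> + \<sigma> * d = \<gamma>] (rmod (2 * pi))"
    using \<sigma>(2) rcong_add_left_cancel by metis
  then have "T + \<rho> * d \<in> rs_path_lengths \<rho> p \<alpha> q \<gamma>"
    using rs_path_lengths_add[OF assms(2) rs_path_lengths_turn_on_spot[OF assms(1) \<sigma>(1) d]]
      rs_path_lengths_rcong by simp
  moreover have "T + \<rho> * d \<le> T + \<rho> * \<bar>\<gamma> - \<beta>\<bar>"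
    using assms(1) d_le by simp
  ultimately show ?thesis by blast
qed

section \<open>Dependence of the distance on the final orientation\<close>

lemma bdd_below_rs_path_lengths: "bdd_below (rs_path_lengths \<rho> p \<alpha> q \<beta>)"
  by (rule bdd_belowI[of _ 0]) (auto simp: rs_path_lengths_def reeds_shepp_path_def)

text \<open>Each path ending at \<beta> can be continued by a turn to \<gamma>, and the resulting
  bound passes to the infima.\<close>

lemma rs_dist_turn_le:
  assumes "\<rho> > 0"
  shows "rs_dist \<rho> p \<alpha> q \<gamma> \<le> rs_dist \<rho> p \<alpha> q \<beta> + \<rho> * \<bar>\<gamma> - \<beta>\<bar>"
proof (cases "rs_path_lengths \<rho> p \<alpha> q \<beta> = {}")
  case True
  \<comment> \<open>This case is void, but it costs less to note that both distances are the junk value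
    \<^term>\<open>Inf {} :: real\<close> than to show that any two configurations can be joined.\<close>
  then have "rs_path_lengths \<rho> p \<alpha> q \<gamma> = {}"
    using rs_path_lengths_turn[OF assms] by blast
  then show ?thesis
    using True assms by (simp add: rs_dist_def)
next
  case False
  have "rs_dist \<rho> p \<alpha> q \<gamma> - \<rho> * \<bar>\<gamma> - \<beta>\<bar> \<le> rs_dist \<rho> p \<alpha> q \<beta>"
    unfolding rs_dist_def[of _ _ _ _ \<beta>]
  proof (rule cInf_greatest[OF False])
    fix T assume "T \<in> rs_path_lengths \<rho> p \<alpha> q \<beta>"
    then obtain T' where "T' \<in> rs_path_lengths \<rho> p \<alpha> q \<gamma>" "T' \<le> T + \<rho> * \<bar>\<gamma> - \<beta>\<bar>"
      using rs_path_lengths_turn[OF assms] by blast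
    then show "rs_dist \<rho> p \<alpha> q \<gamma> - \<rho> * \<bar>\<gamma> - \<beta>\<bar> \<le> T"
      using cInf_lower[OF _ bdd_below_rs_path_lengths, of T' \<rho> p \<alpha> q \<gamma>]
      unfolding rs_dist_def by linarith
  qed
  then show ?thesis by simp
qed

section \<open>Legs of the tour and the final bound\<close>

lemma subinterval_diff_le:
  assumes "a \<in> subinterval k lo hi i m" "b \<in> subinterval k lo hi i m" "lo i < hi i"
  shows "\<bar>a - b\<bar> \<le> (hi i - lo i) / real k"
proof -
  have "\<bar>a - b\<bar> \<le> grid_point k lo hi i m - grid_point k lo hi i (m - 1)"
    using assms by (auto simp: subinterval_def)
  also have "\<dots> = (real m - real (m - 1)) * ((hi i - lo i) / real k)"
    by (simp add: grid_point_def algebra_simps diff_divide_distrib)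
  \<comment> \<open>The first factor is 1 for positive \<open>m\<close>, and 0 for
    \<open>m = 0\<close> because subtraction on naturals truncates.\<close>
  also have "\<dots> \<le> 1 * ((hi i - lo i) / real k)"
    by (rule mult_right_mono) (use assms in auto)
  finally show ?thesis by simp
qed

text \<open>A leg keeps its optimal departure angle \<alpha>, while its arrival angle \<beta> is
  replaced by another angle of the same subinterval. In the tour, \<gamma> is the departure angle of
  the next leg.\<close>

lemma rs_dist_le_interval_cost:
  assumes "\<rho> > 0" "lo j < hi j"
    and "is_cost_minimizer \<rho> k pos lo hi (i, m) (j, l) \<alpha> \<beta>" "\<gamma> \<in> subinterval k lo hi j l"
  shows "rs_dist \<rho> (pos i) \<alpha> (pos j) \<gamma>
           \<le> interval_cost \<rho> k pos lo hi (i, m) (j, l) + \<rho> * ((hi j - lo j) / real k)"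
proof -
  have \<beta>: "\<beta> \<in> subinterval k lo hi j l"
    and c: "rs_dist \<rho> (pos i) \<alpha> (pos j) \<beta> = interval_cost \<rho> k pos lo hi (i, m) (j, l)"
    using assms(3) by (auto simp: is_cost_minimizer_def)
  have "rs_dist \<rho> (pos i) \<alpha> (pos j) \<gamma> \<le> rs_dist \<rho> (pos i) \<alpha> (pos j) \<beta> + \<rho> * \<bar>\<gamma> - \<beta>\<bar>"
    by (rule rs_dist_turn_le[OF assms(1)])
  also have "\<rho> * \<bar>\<gamma> - \<beta>\<bar> \<le> \<rho> * ((hi j - lo j) / real k)"
    by (rule mult_left_mono[OF subinterval_diff_le[OF assms(4) \<beta> assms(2)]]) (use assms(1) in simp)
  finally show ?thesis using c by simp
qed

theorem corollary1:
  fixes n k :: nat and \<rho> :: real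
    and pos :: "nat \<Rightarrow> real \<times> real"
    and lo hi :: "nat \<Rightarrow> real"
    and s :: "nat \<Rightarrow> nat" and \<theta> :: "nat \<Rightarrow> real"
  assumes "n \<ge> 2" and "k \<ge> 1" and "\<rho> > 0"
    and "\<And>i. i \<in> {1..n} \<Longrightarrow> lo i < hi i"
    and "approx_result \<rho> n k pos lo hi s \<theta>"
  shows "tour_length \<rho> n pos s \<theta>
           \<le> tsp_lower_bound \<rho> n k pos lo hi
             + 3 * \<rho> * (\<Sum>i=1..n. (hi (s i) - lo (s i)) / real k)"
proof -
  obtain m arr dep where sol: "(s, m) \<in> tsp_solutions n k"
    and cost: "tsp_cost \<rho> n k pos lo hi (s, m) = tsp_lower_bound \<rho> n k pos lo hi"
    and mid': "\<forall>i\<in>{1..n-1}. is_cost_minimizer \<rho> k pos lo hi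
            (s i, m i) (s (i+1), m (i+1)) (dep (s i)) (arr (s (i+1)))"
    and last: "is_cost_minimizer \<rho> k pos lo hi (s n, m n) (s 1, m 1) (dep (s n)) (arr (s 1))"
    and opt: "is_arg_min (tour_length \<rho> n pos s)
          (\<lambda>\<theta>'. \<forall>i\<in>{1..n}. \<theta>' (s i) \<in> {arr (s i), dep (s i)}) \<theta>"
    using assms(5) unfolding approx_result_def by (elim exE conjE) (rule that)
  have mid: "is_cost_minimizer \<rho> k pos lo hi
      (s i, m i) (s (i+1), m (i+1)) (dep (s i)) (arr (s (i+1)))" if "i \<in> {1..n-1}" for i
    using mid' that by (rule bspec)
  let ?w = "\<lambda>i. (hi (s i) - lo (s i)) / real k"
  let ?c = "\<lambda>i j. interval_cost \<rho> k pos lo hi (s i, m i) (s j, m j)"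
  let ?d = "\<lambda>i j. rs_dist \<rho> (pos (s i)) (dep (s i)) (pos (s j)) (dep (s j))"
  have "s permutes {1..n}"
    using sol by (auto simp: tsp_solutions_def)
  then have lohi: "lo (s i) < hi (s i)" if "i \<in> {1..n}" for i
    using that assms(4)[of "s i"] permutes_in_image[of s "{1..n}" i] by simp
  \<comment> \<open>One index \<open>m i\<close> serves both legs at \<open>s i\<close>, so its
    departure angle lies in the subinterval that also contains its arrival angle. For
    \<open>i = n\<close> the outgoing leg is the closing one.\<close>
  have dep: "dep (s i) \<in> subinterval k lo hi (s i) (m i)" if "i \<in> {1..n}" for i
    using that mid[of i] last by (cases "i = n") (auto simp: is_cost_minimizer_def)
  have step: "?d i (i + 1) \<le> ?c i (i + 1) + \<rho> * ?w (i + 1)" if "i \<in> {1..n-1}" for i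
    by (rule rs_dist_le_interval_cost[where pos = pos, OF assms(3) lohi mid[OF that] dep]) (use that in auto)
  have step_last: "?d n 1 \<le> ?c n 1 + \<rho> * ?w 1"
    by (rule rs_dist_le_interval_cost[where pos = pos, OF assms(3) lohi last dep]) (use assms(1) in auto)
  \<comment> \<open>Every waypoint is charged once, by the leg that enters it; the first one is
    charged by the closing leg.\<close>
  have sum_w: "(\<Sum>i=1..n-1. ?w (i + 1)) + ?w 1 = (\<Sum>i=1..n. ?w i)"
  proof -
    have "(\<Sum>i=1..n. ?w i) = ?w 1 + (\<Sum>i=Suc 1..Suc (n-1). ?w i)"
      using assms(1) sum.atLeast_Suc_atMost[of 1 n ?w] by simp
    then show ?thesis
      unfolding sum.shift_bounds_cl_Suc_ivl by simp
  qed
  \<comment> \<open>Taking the departure angle everywhere is one of the choices over which \<theta>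
    is optimal.\<close>
  have "tour_length \<rho> n pos s \<theta> \<le> tour_length \<rho> n pos s dep"
    using opt by (auto simp: is_arg_min_def not_less)
  also have "\<dots> = (\<Sum>i=1..n-1. ?d i (i + 1)) + ?d n 1"
    by (simp add: tour_length_def)
  also have "\<dots> \<le> (\<Sum>i=1..n-1. ?c i (i + 1) + \<rho> * ?w (i + 1)) + (?c n 1 + \<rho> * ?w 1)"
    by (intro add_mono sum_mono step step_last)
  also have "\<dots> = tsp_cost \<rho> n k pos lo hi (s, m) + \<rho> * ((\<Sum>i=1..n-1. ?w (i + 1)) + ?w 1)"
    unfolding tsp_cost_def by (simp only: sum.distrib sum_distrib_left distrib_left prod.case)
  also have "\<dots> = tsp_lower_bound \<rho> n k pos lo hi + 1 * \<rho> * (\<Sum>i=1..n. ?w i)"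
    unfolding sum_w cost by simp
  also have "\<dots> \<le> tsp_lower_bound \<rho> n k pos lo hi + 3 * \<rho> * (\<Sum>i=1..n. ?w i)"
    by (intro add_left_mono mult_right_mono sum_nonneg divide_nonneg_nonneg)
      (use assms(3) lohi in \<open>auto intro: less_imp_le\<close>)
  finally show ?thesis .
qed

end
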